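(* Suppose that a compact measured length space $(X,d,\nu)$ has $\infty$-Ricci curvature bounded below by $K>0$. Then for all $h\in\mathrm{Lip}(X)$ with $\int_X h\,d\nu=0$, we have $$\int_X h^2\,d\nu\le\frac1K\int_X|\nabla h|^2\,d\nu.$$
   Context: $\mathrm{Lip}(X)$ is the set of real-valued Lipschitz functions on $X$, and $|\nabla h|(x)=\limsup_{y\to x}\frac{|h(y)-h(x)|}{d(x,y)}$ (with value $0$ at isolated points). A compact measured length space $(X,d,\nu)$ is a compact length space $(X,d)$ (the distance is the infimum of lengths of joining curves) with a Borel probability measure $\nu$. $P_2(X)$ is the set of Borel probability measures on $X$ with the quadratic Wasserstein metric $W_2(\mu_0,\mu_1)^2=\inf_\pi\int d(x_0,x_1)^2\,d\pi$ ($\pi$ ranging over couplings of $\mu_0,\mu_1$). A Wasserstein geodesic $\{\mu_t\}_{t\in[0,1]}$ is a minimizing geodesic of $P_2(X)$, parametrized so that $W_2(\mu_t,\mu_s)=|t-s|W_2(\mu_0,\mu_1)$. For a continuous convex $U:[0,\infty)\to\mathbb{R}$ with $U(0)=0$, put $U'(\infty)=\lim_{r\to\infty}U(r)/r$ and $U_\nu(\mu)=\int_X U(\rho)\,d\nu+U'(\infty)\mu_s(X)\in\mathbb{R}\cup\{\infty\}$, where $\mu=\rho\nu+\mu_s$ is the Lebesgue decomposition of $\mu$ with respect to $\nu$ (convention $\infty\cdot0=0$). $\mathcal{DC}_\infty$ is the set of such $U$ for which $\lambda\mapsto e^\lambda U(e^{-\lambda})$ is convex on $\mathbb{R}$. Given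 $K\in\mathbb{R}$, for $U\in\mathcal{DC}_\infty$ put $p(r)=rU'_+(r)-U(r)$ ($U'_+$ the right derivative) and $\lambda(U)=\inf_{r>0}K\frac{p(r)}{r}\in\mathbb{R}\cup\{-\infty\}$. $(X,d,\nu)$ has $\infty$-Ricci curvature bounded below by $K$ if for all $\mu_0,\mu_1\in P_2(X)$ with supports in $\mathrm{supp}(\nu)$ there is some Wasserstein geodesic $\{\mu_t\}$ from $\mu_0$ to $\mu_1$ such that for all $U\in\mathcal{DC}_\infty$ and $t\in[0,1]$: $U_\nu(\mu_t)\le tU_\nu(\mu_1)+(1-t)U_\nu(\mu_0)-\frac12\lambda(U)t(1-t)W_2(\mu_0,\mu_1)^2$. *)

theory Defs
  imports "HOL-Probability.Probability"
begin

text \<open>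
  The space \<open>(X, d)\<close> is the universe of a type of class \<open>metric_space\<close>, with \<open>d = dist\<close>.
\<close>

definition curve_length :: "(real \<Rightarrow> 'a::metric_space) \<Rightarrow> ennreal" where
  "curve_length g =
     (SUP (n, s) \<in> {(n, s :: nat \<Rightarrow> real). s 0 = 0 \<and> s n = 1 \<and> (\<forall>i<n. s i \<le> s (Suc i))}.
        \<Sum>i<n. ennreal (dist (g (s i)) (g (s (Suc i)))))"

definition length_space :: "'a::metric_space itself \<Rightarrow> bool" where
  "length_space (_ :: 'a itself) \<longleftrightarrow>
     (\<forall>x y :: 'a. ennreal (dist x y) =
        (INF g \<in> {g. path g \<and> pathstart g = x \<and> pathfinish g = y}. curve_length g))"

definition borel_probability_measures :: "'a::topological_space measure set" where
  "borel_probability_measures = {\<mu>. prob_space \<mu> \<and> sets \<mu> = sets borel}"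

definition compact_measured_length_space :: "'a::metric_space measure \<Rightarrow> bool" where
  "compact_measured_length_space (\<nu> :: 'a measure) \<longleftrightarrow>
     compact (UNIV :: 'a set) \<and> length_space TYPE('a) \<and> \<nu> \<in> borel_probability_measures"

definition Lip :: "('a::metric_space \<Rightarrow> real) set" where
  "Lip = {h. \<exists>L. L-lipschitz_on UNIV h}"

text \<open>
  For Lipschitz \<open>h\<close> the upper limit is finite at every non-isolated point. At an isolated
  point \<open>at x\<close> is the trivial filter, whose upper limit in \<open>ereal\<close> would be \<open>-\<infinity>\<close>.
\<close>

definition local_slope :: "('a::metric_space \<Rightarrow> real) \<Rightarrow> 'a \<Rightarrow> real" where
  "local_slope h x =
     (if x islimpt UNIV
      then real_of_ereal (Limsup (at x) (\<lambda>y. ereal (\<bar>h y - h x\<bar> / dist x y)))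
      else 0)"

definition couplings :: "'a::topological_space measure \<Rightarrow> 'a measure \<Rightarrow> ('a \<times> 'a) measure set" where
  "couplings \<mu>0 \<mu>1 =
     {\<pi>. sets \<pi> = sets borel \<and> distr \<pi> borel fst = \<mu>0 \<and> distr \<pi> borel snd = \<mu>1}"

text \<open>On a compact space the infimum below is finite, so \<open>enn2real\<close> loses nothing.\<close>

definition W2 :: "'a::metric_space measure \<Rightarrow> 'a measure \<Rightarrow> real" where
  "W2 \<mu>0 \<mu>1 =
     sqrt (enn2real (INF \<pi> \<in> couplings \<mu>0 \<mu>1. \<integral>\<^sup>+z. ennreal ((dist (fst z) (snd z))\<^sup>2) \<partial>\<pi>))"

definition wasserstein_geodesic ::
    "(real \<Rightarrow> 'a::metric_space measure) \<Rightarrow> 'a measure \<Rightarrow> 'a measure \<Rightarrow> bool" where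
  "wasserstein_geodesic \<mu> \<mu>0 \<mu>1 \<longleftrightarrow>
     \<mu> 0 = \<mu>0 \<and> \<mu> 1 = \<mu>1 \<and>
     (\<forall>t\<in>{0..1}. \<mu> t \<in> borel_probability_measures) \<and>
     (\<forall>t\<in>{0..1}. \<forall>s\<in>{0..1}. W2 (\<mu> t) (\<mu> s) = \<bar>t - s\<bar> * W2 \<mu>0 \<mu>1)"

definition measure_supp :: "'a::topological_space measure \<Rightarrow> 'a set" where
  "measure_supp \<mu> = {x. \<forall>V. open V \<longrightarrow> x \<in> V \<longrightarrow> emeasure \<mu> V > 0}"

text \<open>
  A function \<open>[0,\<infinity>) \<rightarrow> \<real>\<close> is represented by \<open>U :: real \<Rightarrow> real\<close>; its values at negative
  arguments are never used.
\<close>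

definition DC_inf :: "(real \<Rightarrow> real) set" where
  "DC_inf = {U. continuous_on {0..} U \<and> convex_on {0..} U \<and> U 0 = 0 \<and>
                convex_on UNIV (\<lambda>l. exp l * U (exp (- l)))}"

definition U_prime_inf :: "(real \<Rightarrow> real) \<Rightarrow> ereal" where
  "U_prime_inf U = Lim at_top (\<lambda>r. ereal (U r / r))"

definition lebesgue_decomposition ::
    "'a measure \<Rightarrow> 'a measure \<Rightarrow> ('a \<Rightarrow> real) \<Rightarrow> 'a measure \<Rightarrow> bool" where
  "lebesgue_decomposition \<nu> \<mu> \<rho> \<mu>s \<longleftrightarrow>
     \<rho> \<in> borel_measurable \<nu> \<and> (\<forall>x. 0 \<le> \<rho> x) \<and> sets \<mu>s = sets \<nu> \<and>
     (\<forall>A\<in>sets \<nu>. emeasure \<mu> A = (\<integral>\<^sup>+x\<in>A. ennreal (\<rho> x) \<partial>\<nu>) + emeasure \<mu>s A) \<and>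
     (\<exists>N\<in>sets \<nu>. emeasure \<nu> N = 0 \<and> emeasure \<mu>s (space \<nu> - N) = 0)"

text \<open>Only meaningful if at least one of the two parts is finite.\<close>

definition extended_integral :: "'a measure \<Rightarrow> ('a \<Rightarrow> real) \<Rightarrow> ereal" where
  "extended_integral M f =
     enn2ereal (\<integral>\<^sup>+x. ennreal (f x) \<partial>M) - enn2ereal (\<integral>\<^sup>+x. ennreal (- f x) \<partial>M)"

text \<open>
  The Lebesgue decomposition exists and is unique up to \<open>\<nu>\<close>-null modification of \<open>\<rho>\<close>, so the
  value does not depend on the choice. As \<open>U\<close> is bounded below by an affine function, the
  negative part of \<open>U \<circ> \<rho>\<close> is integrable, and \<open>U_prime_inf U > -\<infinity>\<close>; hence no \<open>\<infinity> - \<infinity>\<close> occurs.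
  In \<open>ereal\<close>, \<open>\<infinity> * 0 = 0\<close>.
\<close>

definition U_functional :: "'a measure \<Rightarrow> (real \<Rightarrow> real) \<Rightarrow> 'a measure \<Rightarrow> ereal" where
  "U_functional \<nu> U \<mu> =
     (let (\<rho>, \<mu>s) = (SOME (\<rho>, \<mu>s). lebesgue_decomposition \<nu> \<mu> \<rho> \<mu>s)
      in extended_integral \<nu> (\<lambda>x. U (\<rho> x)) + U_prime_inf U * enn2ereal (emeasure \<mu>s (space \<nu>)))"

definition pressure :: "(real \<Rightarrow> real) \<Rightarrow> real \<Rightarrow> real" where
  "pressure U r = r * vector_derivative U (at_right r) - U r"

definition lambda_K :: "real \<Rightarrow> (real \<Rightarrow> real) \<Rightarrow> ereal" where
  "lambda_K K U = (INF r \<in> {0<..}. ereal (K * (pressure U r / r)))"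

definition inf_Ricci_bounded_below :: "'a::metric_space measure \<Rightarrow> real \<Rightarrow> bool" where
  "inf_Ricci_bounded_below \<nu> K \<longleftrightarrow>
     (\<forall>\<mu>0 \<in> borel_probability_measures. \<forall>\<mu>1 \<in> borel_probability_measures.
        measure_supp \<mu>0 \<subseteq> measure_supp \<nu> \<longrightarrow> measure_supp \<mu>1 \<subseteq> measure_supp \<nu> \<longrightarrow>
        (\<exists>\<mu>. wasserstein_geodesic \<mu> \<mu>0 \<mu>1 \<and>
           (\<forall>U\<in>DC_inf. \<forall>t\<in>{0..1}.
              U_functional \<nu> U (\<mu> t) \<le>
                ereal t * U_functional \<nu> U \<mu>1 + ereal (1 - t) * U_functional \<nu> U \<mu>0
                - ereal (1/2) * lambda_K K U * ereal (t * (1 - t) * (W2 \<mu>0 \<mu>1)\<^sup>2))))"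

end

theory Submission
  imports Defs
begin

text \<open>
  Apply the curvature condition to the entropy \<open>U r = r ln r\<close>, for which \<open>\<lambda>(U) = K\<close>, along a
  geodesic \<open>\<mu>\<^sub>t\<close> from \<open>\<mu>\<^sub>0 = (1 + \<epsilon>h)\<nu>\<close> to \<open>\<nu>\<close>. Writing \<open>\<phi> = ln (1 + \<epsilon>h)\<close> and \<open>H = U\<^sub>\<nu>(\<mu>\<^sub>0)\<close>, the
  Gibbs inequality gives \<open>\<integral>\<phi> d\<mu>\<^sub>t \<le> U\<^sub>\<nu>(\<mu>\<^sub>t) \<le> (1 - t) H - K/2 t(1 - t) W\<^sup>2\<close>, while transporting \<open>\<mu>\<^sub>0\<close>
  to \<open>\<mu>\<^sub>t\<close> at cost \<open>t\<^sup>2W\<^sup>2\<close> bounds \<open>H - \<integral>\<phi> d\<mu>\<^sub>t\<close> through the difference quotients of \<open>h\<close> at scale \<open>r\<close>.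
  Letting \<open>t \<rightarrow> 0\<close> yields a logarithmic Sobolev inequality at scale \<open>r\<close>; \<open>\<epsilon> \<rightarrow> 0\<close> linearizes it to a
  Poincare inequality, and \<open>r \<rightarrow> 0\<close> turns the difference quotients into the local slope.
\<close>

section \<open>The entropy function\<close>

text \<open>The factor \<open>r\<close> gives the value \<open>0\<close> at \<open>0\<close>
  whatever \<open>ln 0\<close> is, as membership in \<open>DC_inf\<close> requires.\<close>

definition ent :: "real \<Rightarrow> real" where
  "ent r = r * ln r"

text \<open>The left side is the tangent line of \<open>ent\<close> at \<open>s\<close>; the bound
  is \<open>ln x \<le> x - 1\<close> at \<open>x = s / r\<close>. Convexity of \<open>ent\<close>,
  its lower bound and the Gibbs inequality all come from it.\<close>

lemma ent_ge_tangent: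
  assumes "0 \<le> r" "0 < s"
  shows "r * ln s + r - s \<le> ent r"
proof (cases "r = 0")
  case False
  then have r: "0 < r" using assms by simp
  have "ln (s / r) \<le> s / r - 1"
    using r assms by (intro ln_le_minus_one) simp
  then have "r * (ln s - ln r) \<le> r * (s / r - 1)"
    using r assms by (intro mult_left_mono) (simp_all add: ln_div)
  also have "\<dots> = s - r"
    using r by (simp add: field_simps)
  finally show ?thesis
    by (simp add: ent_def algebra_simps)
qed (use assms in \<open>simp add: ent_def\<close>)

lemma ent_ge: "-1 \<le> ent r" if "0 \<le> r"
  using ent_ge_tangent[OF that, of 1] that by simp

text \<open>The left side is the cubic Taylor polynomial of \<open>ent\<close> at \<open>1\<close>.
  The difference \<open>f\<close> has second derivative \<open>x\<^sup>2 / (1 + x) \<ge> 0\<close>,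
  so it lies above its tangent at \<open>0\<close>, which is zero. In the linearization the
  quadratic term produces the variance and the cubic one is an error term.\<close>

lemma ent_1_plus_ge:
  assumes "-1 < x"
  shows "x + x\<^sup>2 / 2 - x ^ 3 / 6 \<le> ent (1 + x)"
proof -
  define f where "f x = ent (1 + x) - x - x\<^sup>2 / 2 + x ^ 3 / 6" for x :: real
  define f' where "f' x = ln (1 + x) - x + x\<^sup>2 / 2" for x :: real
  have f: "(f has_real_derivative f' x) (at x)" if "-1 < x" for x
    unfolding f_def[abs_def] f'_def ent_def using that
    by (auto intro!: derivative_eq_intros simp: power2_eq_square)
  have f': "(f' has_real_derivative 1 / (1 + x) - 1 + x) (at x)" if "-1 < x" for x
    unfolding f'_def[abs_def] using that
    by (auto intro!: derivative_eq_intros simp: field_simps)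
  have "1 / (1 + x) - 1 + x = x\<^sup>2 / (1 + x)" if "-1 < x" for x :: real
    using that by (simp add: field_simps power2_eq_square)
  then have "convex_on {-1<..} f"
    by (intro f''_ge0_imp_convex[OF _ f f']) auto
  then have "f' 0 * (x - 0) \<le> f x - f 0"
    using assms f[of 0]
    by (intro convex_on_imp_above_tangent[where A = "{-1<..}"])
      (auto simp: interior_open intro: has_field_derivative_at_within)
  then show ?thesis
    by (simp add: f_def f'_def ent_def)
qed

lemma convex_on_ent: "convex_on {0..} ent"
proof (rule convex_onI)
  fix t x y :: real
  assume t: "0 < t" "t < 1" and xy: "x \<in> {0..}" "y \<in> {0..}"
  define s where "s = (1 - t) * x + t * y"
  have "0 \<le> s"
    using t xy by (simp add: s_def)
  show "ent ((1 - t) *\<^sub>R x + t *\<^sub>R y) \<le> (1 - t) * ent x + t * ent y"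
  proof (cases "s = 0")
    case True
    then have "x = 0" "y = 0"
      using t xy unfolding s_def
      by (auto simp: add_nonneg_eq_0_iff)
    then show ?thesis by (simp add: ent_def)
  next
    case False
    \<comment> \<open>Averaging the tangents taken at the convex combination \<open>s\<close> itself
      cancels the affine terms and leaves \<open>ent s\<close>. The tangent exists only for
      \<open>s > 0\<close>, hence the case split.\<close>
    have "(1 - t) * (x * ln s + x - s) + t * (y * ln s + y - s) \<le> (1 - t) * ent x + t * ent y"
      using False \<open>0 \<le> s\<close> t xy by (intro add_mono mult_left_mono ent_ge_tangent) auto
    moreover have "(1 - t) * (x * ln s + x - s) + t * (y * ln s + y - s) = s * ln s"
      by (simp add: s_def algebra_simps)
    ultimately show ?thesis
      by (simp add: ent_def s_def)
  qed
qed simp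

lemma continuous_on_ent: "continuous_on {0..} ent"
proof -
  have "(ent \<longlongrightarrow> ent 0) (at_right 0)"
  proof -
    have "((\<lambda>x::real. x * ln x) \<longlongrightarrow> 0) (at_right 0)"
    proof -
      \<comment> \<open>Substituting \<open>1 / x\<close> turns the limit at \<open>0\<close> into
        that of \<open>ln x / x\<close> at infinity.\<close>
      have "((\<lambda>x::real. - (ln (inverse x) / inverse x)) \<longlongrightarrow> - 0) (at_right 0)"
        by (intro tendsto_minus filterlim_compose[OF ln_x_over_x_tendsto_0] filterlim_inverse_at_top_right)
      moreover have "eventually (\<lambda>x::real. - (ln (inverse x) / inverse x) = x * ln x) (at_right 0)"
        using eventually_at_right_less[of 0] by eventually_elim (simp add: ln_inverse divide_inverse mult.commute)
      ultimately show ?thesis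
        by (simp add: filterlim_cong)
    qed
    then show ?thesis by (simp add: ent_def[abs_def])
  qed
  then have "continuous (at x within {0..}) ent" if "0 \<le> x" for x
  proof (cases "x = 0")
    case True
    have "at 0 within {0::real..} = at_right 0"
      by (rule at_within_Ici_at_right)
    then show ?thesis
      using True \<open>(ent \<longlongrightarrow> ent 0) (at_right 0)\<close> by (simp add: continuous_within)
  next
    case False
    then have "isCont ent x"
      using that unfolding ent_def[abs_def] by (intro continuous_intros) auto
    then show ?thesis
      by (rule continuous_at_imp_continuous_at_within)
  qed
  then show ?thesis
    by (simp add: continuous_on_eq_continuous_within)
qed

lemma ent_in_DC_inf: "ent \<in> DC_inf"
proof -
  have "(\<lambda>l. exp l * ent (exp (- l))) = (\<lambda>l. - l)"
    by (simp add: ent_def fun_eq_iff flip: exp_add)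
  moreover have "convex_on UNIV (\<lambda>l::real. - l)"
    by (intro convex_onI) (auto simp: algebra_simps)
  ultimately show ?thesis
    using continuous_on_ent convex_on_ent by (simp add: DC_inf_def) (simp add: ent_def)
qed

text \<open>Superlinear growth: a measure with a nonzero singular part has infinite entropy, so the
  Gibbs inequality is trivial for it.\<close>

lemma U_prime_inf_ent: "U_prime_inf ent = \<infinity>"
proof -
  have "((\<lambda>r. ereal (ln r)) \<longlongrightarrow> \<infinity>) at_top"
    using ln_at_top by (simp add: tendsto_PInfty_eq_at_top)
  moreover have "eventually (\<lambda>r::real. ereal (ln r) = ereal (ent r / r)) at_top"
    using eventually_gt_at_top[of 0] by eventually_elim (simp add: ent_def)
  ultimately have "((\<lambda>r. ereal (ent r / r)) \<longlongrightarrow> \<infinity>) at_top"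
    by (rule Lim_transform_eventually)
  then show ?thesis
    unfolding U_prime_inf_def by (intro tendsto_Lim) auto
qed

text \<open>The pressure of the entropy is linear, so the infimum defining \<open>lambda_K\<close>
  runs over a constant and equals \<open>K\<close> exactly.\<close>

lemma pressure_ent:
  assumes "0 < r"
  shows "pressure ent r = r"
proof -
  have "(ent has_real_derivative (ln r + 1)) (at r within {r<..})"
    unfolding ent_def[abs_def] using assms by (auto intro!: derivative_eq_intros)
  then have "vector_derivative ent (at_right r) = ln r + 1"
    by (intro vector_derivative_within) (auto simp: has_real_derivative_iff_has_vector_derivative)
  then show ?thesis
    by (simp add: pressure_def ent_def algebra_simps)
qed

lemma lambda_K_ent: "lambda_K K ent = ereal K"
proof -
  have "lambda_K K ent = (INF r\<in>{0::real<..}. ereal K)"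
    by (simp add: lambda_K_def pressure_ent cong: image_cong_simp)
  then show ?thesis by simp
qed

section \<open>Suprema of difference quotients\<close>

text \<open>A local slope at scale \<open>r\<close>: unlike the limit, it controls every increment
  from \<open>x\<close> to a point closer than \<open>r\<close>. The centre \<open>y = x\<close>
  contributes \<open>0 / 0 = 0\<close>, which makes the supremum nonnegative and gives
  \<open>0\<close> at isolated points for small \<open>r\<close>.\<close>

definition slope_within :: "('a::metric_space \<Rightarrow> real) \<Rightarrow> real \<Rightarrow> 'a \<Rightarrow> real" where
  "slope_within h r x = (SUP y\<in>ball x r. \<bar>h y - h x\<bar> / dist x y)"

context
  fixes h :: "'a::metric_space \<Rightarrow> real" and L :: real
  assumes lip: "L-lipschitz_on UNIV h"
begin

lemma quotient_le: "\<bar>h y - h x\<bar> / dist x y \<le> L"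
proof -
  have "0 \<le> L" "\<bar>h y - h x\<bar> \<le> L * dist x y"
    using lipschitz_on_nonneg[OF lip] lipschitz_onD[OF lip, of x y] by (auto simp: dist_real_def)
  then show ?thesis
    by (cases "x = y") (auto simp: divide_le_eq)
qed

lemma bdd_above_quotient: "bdd_above ((\<lambda>y. \<bar>h y - h x\<bar> / dist x y) ` S)"
  using quotient_le by (auto intro!: bdd_aboveI[of _ L])

lemma quotient_le_slope_within:
  "dist x y < r \<Longrightarrow> \<bar>h y - h x\<bar> / dist x y \<le> slope_within h r x"
  unfolding slope_within_def by (intro cSUP_upper bdd_above_quotient) auto

lemma slope_within_nonneg: "0 < r \<Longrightarrow> 0 \<le> slope_within h r x"
  using quotient_le_slope_within[of x x r] by simp

lemma slope_within_le: "0 < r \<Longrightarrow> slope_within h r x \<le> L"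
  unfolding slope_within_def by (intro cSUP_least quotient_le) auto

lemma diff_le_slope_within:
  assumes "dist x y < r"
  shows "\<bar>h x - h y\<bar> \<le> slope_within h r x * dist x y"
  using quotient_le_slope_within[OF assms]
  by (cases "x = y") (auto simp: divide_le_eq abs_minus_commute)

text \<open>The slope is lower semicontinuous, as a supremum of functions that are continuous where
  they are positive.\<close>

lemma slope_within_measurable: "slope_within h r \<in> borel_measurable borel" if "0 < r"
proof (rule borel_measurableI_greater)
  fix a :: real
  show "{x \<in> space borel. a < slope_within h r x} \<in> sets borel"
  proof (cases "a < 0")
    case True
    then have "{x. a < slope_within h r x} = UNIV"
      using slope_within_nonneg[OF that] by (auto intro: less_le_trans)
    then show ?thesis by simp
  next
    case False
    \<comment> \<open>For \<open>a \<ge> 0\<close> the point \<open>x = y\<close> can be removed,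
      its quotient being \<open>0\<close>; off that point the quotient is continuous in
      \<open>x\<close>.\<close>
    have "{x. a < slope_within h r x} = (\<Union>y. {x \<in> ball y r - {y}. a < \<bar>h y - h x\<bar> / dist x y})"
    proof (intro set_eqI iffI)
      fix x assume "x \<in> {x. a < slope_within h r x}"
      then have "\<exists>y\<in>ball x r. a < \<bar>h y - h x\<bar> / dist x y"
        unfolding slope_within_def using that by (subst (asm) mem_Collect_eq, subst (asm) less_cSUP_iff)
          (auto intro: bdd_above_quotient)
      then obtain y where "dist x y < r" "a < \<bar>h y - h x\<bar> / dist x y"
        by auto
      moreover from this have "x \<noteq> y" using False by auto
      ultimately show "x \<in> (\<Union>y. {x \<in> ball y r - {y}. a < \<bar>h y - h x\<bar> / dist x y})"
        by (auto simp: dist_commute)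
    next
      fix x assume "x \<in> (\<Union>y. {x \<in> ball y r - {y}. a < \<bar>h y - h x\<bar> / dist x y})"
      then obtain y where "dist x y < r" "a < \<bar>h y - h x\<bar> / dist x y"
        by (auto simp: dist_commute)
      then show "x \<in> {x. a < slope_within h r x}"
        using quotient_le_slope_within[of x y r] by auto
    qed
    moreover have "open {x \<in> ball y r - {y}. a < \<bar>h y - h x\<bar> / dist x y}" for y
    proof -
      have "continuous_on (ball y r - {y}) (\<lambda>x. \<bar>h y - h x\<bar> / dist x y)"
        using lipschitz_on_continuous_on[OF lip]
        by (auto intro!: continuous_intros elim: continuous_on_subset)
      then have "open ((\<lambda>x. \<bar>h y - h x\<bar> / dist x y) -` {a<..} \<inter> (ball y r - {y}))"
        by (rule continuous_on_open_vimage[THEN iffD1, rule_format, rotated]) auto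
      then show ?thesis
        by (rule back_subst[where P = "open"]) auto
    qed
    ultimately have "open {x. a < slope_within h r x}"
      by auto
    then show ?thesis
      by (simp add: borel_open)
  qed
qed

text \<open>The upper limit is the infimum over radii of suprema over punctured balls. Filling in
  the centre only adds the value \<open>0\<close>, which changes nothing in the limit because
  quotients are nonnegative.\<close>

lemma slope_within_tendsto: "(\<lambda>n. slope_within h (1 / Suc n) x) \<longlonglongrightarrow> local_slope h x"
proof (cases "x islimpt UNIV")
  case False
  then obtain e where e: "e > 0" "\<And>y. dist y x < e \<Longrightarrow> y = x"
    by (auto simp: islimpt_approachable)
  have "eventually (\<lambda>n. 1 / real (Suc n) < e) sequentially"
    using e LIMSEQ_inverse_real_of_nat[THEN order_tendstoD(2), of e] by (simp add: inverse_eq_divide)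
  then have "eventually (\<lambda>n. slope_within h (1 / Suc n) x = local_slope h x) sequentially"
  proof eventually_elim
    case (elim n)
    have "ball x (1 / Suc n) = {x}"
      using elim e(2) by (auto simp: dist_commute)
    then show ?case
      using False by (simp add: slope_within_def local_slope_def)
  qed
  then show ?thesis
    by (rule tendsto_eventually)
next
  case True
  define q where "q y = \<bar>h y - h x\<bar> / dist x y" for y
  define s where "s = Limsup (at x) (\<lambda>y. ereal (q y))"
  have s_le: "s \<le> ereal (slope_within h r x)" if "0 < r" for r
  proof -
    have "s \<le> (SUP y\<in>ball x r - {x}. ereal (q y))"
      unfolding s_def Limsup_at using that by (intro INF_lower) simp
    also have "\<dots> \<le> ereal (slope_within h r x)"
      by (intro SUP_least) (auto simp: q_def quotient_le_slope_within)
    finally show ?thesis .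
  qed
  \<comment> \<open>Being a limit point makes every punctured ball nonempty, so no supremum is taken
    over the empty set.\<close>
  have "0 \<le> s"
    unfolding s_def Limsup_at
  proof (rule INF_greatest)
    fix e :: real assume "e \<in> {0<..}"
    then obtain y where "y \<noteq> x" "dist y x < e"
      using True by (auto simp: islimpt_approachable)
    then have "ereal (q y) \<le> (SUP y\<in>ball x e - {x}. ereal (q y))"
      by (intro SUP_upper) (auto simp: dist_commute)
    then show "0 \<le> (SUP y\<in>ball x e - {x}. ereal (q y))"
      by (rule order_trans[rotated]) (simp add: q_def)
  qed
  then obtain \<sigma> where \<sigma>: "s = ereal \<sigma>"
    using s_le[of 1] by (cases s) auto
  have slope: "local_slope h x = \<sigma>"
    using True \<sigma> by (simp add: local_slope_def s_def q_def)
  show ?thesis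
    unfolding slope
  proof (rule order_tendstoI)
    fix a assume "a < \<sigma>"
    then show "eventually (\<lambda>n. a < slope_within h (1 / Suc n) x) sequentially"
      using s_le \<sigma> by (intro always_eventually allI) (metis ereal_less_eq(3) less_le_trans zero_less_divide_1_iff of_nat_0_less_iff zero_less_Suc)
  next
    fix a assume a: "\<sigma> < a"
    \<comment> \<open>A supremum of values below \<open>b\<close> may equal \<open>b\<close>, so
      \<open>b\<close> is placed strictly below \<open>a\<close>.\<close>
    define b where "b = (\<sigma> + a) / 2"
    have b: "\<sigma> < b" "b < a" "0 \<le> b"
      using a \<open>0 \<le> s\<close> \<sigma> by (auto simp: b_def)
    have "eventually (\<lambda>y. ereal (q y) < ereal b) (at x)"
      using b \<sigma> by (intro Limsup_lessD) (simp add: s_def)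
    then obtain e where e: "e > 0" "\<And>y. y \<noteq> x \<Longrightarrow> dist y x < e \<Longrightarrow> q y < b"
      by (auto simp: eventually_at)
    have "eventually (\<lambda>n. 1 / real (Suc n) < e) sequentially"
      using e LIMSEQ_inverse_real_of_nat[THEN order_tendstoD(2), of e] by (simp add: inverse_eq_divide)
    then show "eventually (\<lambda>n. slope_within h (1 / Suc n) x < a) sequentially"
    proof eventually_elim
      case (elim n)
      have "q y \<le> b" if "dist x y < 1 / Suc n" for y
        using e(2)[of y] elim that b by (cases "y = x") (auto simp: dist_commute q_def)
      then have "slope_within h (1 / Suc n) x \<le> b"
        unfolding slope_within_def by (intro cSUP_least) (auto simp: q_def)
      then show ?case using b by simp
    qed
  qed
qed

end

section \<open>Couplings\<close>

text \<open>Total boundedness: the union of finite nets of radius \<open>1 / Suc n\<close> is a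
  countable dense set.\<close>

lemma compact_countable_cover:
  assumes "compact (UNIV :: 'a::metric_space set)"
  obtains D :: "'a::metric_space set" where "countable D" "\<And>(x :: 'a) r. 0 < r \<Longrightarrow> \<exists>y\<in>D. dist y x < r"
proof -
  have "\<exists>k. finite k \<and> (UNIV :: 'a set) \<subseteq> (\<Union>x\<in>k. ball x (1 / Suc n))" for n
    using seq_compact_imp_totally_bounded[of "UNIV :: 'a set"] assms
    by (simp add: compact_eq_seq_compact_metric)
  then obtain k where k: "\<And>n. finite (k n)" "\<And>n. (UNIV :: 'a set) \<subseteq> (\<Union>x\<in>k n. ball x (1 / Suc n))"
    by metis
  show thesis
  proof (rule that[of "\<Union>n. k n"])
    show "countable (\<Union>n. k n)"
      using k(1) by (auto intro: countable_finite)
  next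
    fix x :: 'a and r :: real assume "0 < r"
    then obtain n where "1 / Suc n < r"
      using nat_approx_posE by blast
    moreover obtain y where "y \<in> k n" "dist y x < 1 / Suc n"
      using k(2)[of n] by (auto dest: subsetD[OF _ UNIV_I[of x]])
    ultimately show "\<exists>y\<in>\<Union>n. k n. dist y x < r"
      by (intro bexI[of _ y]) auto
  qed
qed

text \<open>The class-based \<open>borel_prod\<close> needs second countability, which is not available for the
  type here but follows from compactness.\<close>

lemma compact_borel_prod:
  assumes "compact (UNIV :: 'a::metric_space set)"
  shows "sets (borel \<Otimes>\<^sub>M borel) = sets (borel :: ('a \<times> 'a) measure)"
proof
  obtain D :: "'a set" where D: "countable D" "\<And>x r. 0 < r \<Longrightarrow> \<exists>y\<in>D. dist y x < r"
    using compact_countable_cover[OF assms] by blast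
  have "S \<in> sets (borel \<Otimes>\<^sub>M borel)" if "open S" for S :: "('a \<times> 'a) set"
  proof -
    define I where "I = {(x, y, n). x \<in> D \<and> y \<in> D \<and> ball x (1 / Suc n) \<times> ball y (1 / Suc n) \<subseteq> S}"
    have "S \<subseteq> (\<Union>(x, y, n)\<in>I. ball x (1 / Suc n) \<times> ball y (1 / Suc n))"
    proof
      fix z assume "z \<in> S"
      obtain a b where z: "z = (a, b)" by (cases z)
      obtain A B where AB: "open A" "open B" "a \<in> A" "b \<in> B" "A \<times> B \<subseteq> S"
        using open_prod_elim[OF \<open>open S\<close> \<open>z \<in> S\<close>] unfolding z by (metis mem_Sigma_iff)
      obtain e where e: "0 < e" "ball a e \<subseteq> A" "ball b e \<subseteq> B"
      proof -
        obtain e1 e2 where "0 < e1" "ball a e1 \<subseteq> A" "0 < e2" "ball b e2 \<subseteq> B"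
          using AB by (meson open_contains_ball)
        then show thesis
          by (intro that[of "min e1 e2"]) (auto simp: subset_iff)
      qed
      \<comment> \<open>Half of \<open>e\<close>, because a ball of radius \<open>1 / Suc n\<close>
        whose centre is that close to \<open>a\<close> reaches less than twice this radius away from
        \<open>a\<close>.\<close>
      obtain n where n: "1 / Suc n < e / 2"
        using nat_approx_posE[of "e / 2"] e by auto
      obtain x y where xy: "x \<in> D" "dist x a < 1 / Suc n" "y \<in> D" "dist y b < 1 / Suc n"
        using D(2)[of "1 / Suc n" a] D(2)[of "1 / Suc n" b] by auto
      have sub: "ball x' (1 / Suc n) \<subseteq> ball a' e" if "dist x' a' < 1 / Suc n" for x' a' :: 'a
      proof
        fix w assume "w \<in> ball x' (1 / Suc n)"
        then show "w \<in> ball a' e"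
          using that n dist_triangle[of a' w x'] by (simp add: dist_commute)
      qed
      have "(x, y, n) \<in> I"
        using xy sub[of x a] sub[of y b] e AB unfolding I_def by blast
      moreover have "z \<in> ball x (1 / Suc n) \<times> ball y (1 / Suc n)"
        using xy by (simp add: z)
      ultimately show "z \<in> (\<Union>(x, y, n)\<in>I. ball x (1 / Suc n) \<times> ball y (1 / Suc n))"
        by blast
    qed
    then have "S = (\<Union>(x, y, n)\<in>I. ball x (1 / Suc n) \<times> ball y (1 / Suc n))"
      by (auto simp: I_def)
    moreover have "countable I"
      by (rule countable_subset[of _ "D \<times> D \<times> UNIV"]) (auto simp: I_def D)
    then have "(\<Union>(x, y, n)\<in>I. ball x (1 / Suc n) \<times> ball y (1 / Suc n)) \<in> sets (borel \<Otimes>\<^sub>M borel)"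
      by (intro sets.countable_UN') auto
    ultimately show ?thesis by simp
  qed
  then show "sets (borel :: ('a \<times> 'a) measure) \<subseteq> sets (borel \<Otimes>\<^sub>M borel)"
    using sets.sigma_sets_subset'[of "Collect open" "borel \<Otimes>\<^sub>M borel" UNIV]
    by (auto simp: borel_def[where 'a = "'a \<times> 'a"])
  show "sets (borel \<Otimes>\<^sub>M borel) \<subseteq> sets (borel :: ('a \<times> 'a) measure)"
  proof -
    \<comment> \<open>Both projections are continuous, so the identity is measurable into the
      product; its preimages give the inclusion.\<close>
    have "id \<in> measurable (borel :: ('a \<times> 'a) measure) (borel \<Otimes>\<^sub>M borel)"
      by (rule measurable_pair) (auto simp: comp_def intro!: borel_measurable_continuous_onI continuous_intros)
    then show ?thesis
      by (auto dest: measurable_sets)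
  qed
qed

text \<open>The product coupling shows that the infimum in \<open>W2\<close> is not over the empty
  set, where it would be infinite. Compactness makes the product measure live on the Borel sets of
  the product.\<close>

lemma pair_measure_in_couplings:
  fixes \<mu>0 \<mu>1 :: "'a::metric_space measure"
  assumes "compact (UNIV :: 'a set)"
    and "\<mu>0 \<in> borel_probability_measures" "\<mu>1 \<in> borel_probability_measures"
  shows "\<mu>0 \<Otimes>\<^sub>M \<mu>1 \<in> couplings \<mu>0 \<mu>1"
proof -
  have [measurable_cong]: "sets \<mu>0 = sets borel" "sets \<mu>1 = sets borel"
    using assms by (auto simp: borel_probability_measures_def)
  interpret \<mu>0: prob_space \<mu>0 using assms by (simp add: borel_probability_measures_def)
  interpret \<mu>1: prob_space \<mu>1 using assms by (simp add: borel_probability_measures_def)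
  have sets: "sets (\<mu>0 \<Otimes>\<^sub>M \<mu>1) = sets borel"
    unfolding compact_borel_prod[OF assms(1), symmetric] by (intro sets_pair_measure_cong) fact+
  have space: "space \<mu>0 = UNIV" "space \<mu>1 = UNIV"
    using assms by (auto simp: borel_probability_measures_def dest: sets_eq_imp_space_eq)
  have "distr (\<mu>0 \<Otimes>\<^sub>M \<mu>1) borel fst = distr (\<mu>0 \<Otimes>\<^sub>M \<mu>1) \<mu>0 fst"
    using assms by (intro distr_cong) (auto simp: borel_probability_measures_def)
  moreover have "distr (\<mu>0 \<Otimes>\<^sub>M \<mu>1) borel snd = \<mu>1"
  proof (rule measure_eqI)
    fix A :: "'a set" assume "A \<in> sets (distr (\<mu>0 \<Otimes>\<^sub>M \<mu>1) borel snd)"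
    then have A: "A \<in> sets borel" "A \<in> sets \<mu>1" by auto
    then have "emeasure (distr (\<mu>0 \<Otimes>\<^sub>M \<mu>1) borel snd) A = emeasure (\<mu>0 \<Otimes>\<^sub>M \<mu>1) (UNIV \<times> A)"
      by (subst emeasure_distr) (auto intro!: arg_cong2[where f = emeasure] simp: space_pair_measure space)
    also have "\<dots> = emeasure \<mu>1 A"
      using A \<mu>0.emeasure_space_1 space \<mu>1.emeasure_pair_measure_Times[of UNIV \<mu>0 A] sets.top[of \<mu>0]
      by simp
    finally show "emeasure (distr (\<mu>0 \<Otimes>\<^sub>M \<mu>1) borel snd) A = emeasure \<mu>1 A" .
  qed (use assms in \<open>simp add: borel_probability_measures_def\<close>)
  ultimately show ?thesis
    using sets by (simp add: couplings_def \<mu>1.distr_pair_fst)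
qed

text \<open>On a bounded space every coupling has cost at most the squared diameter bound, so the
  infimum is finite, \<open>enn2real\<close> preserves it, and it can be approached within
  \<open>\<delta>\<close>.\<close>

lemma ex_coupling_cost_less:
  fixes \<mu>0 \<mu>1 :: "'a::metric_space measure"
  assumes "compact (UNIV :: 'a set)"
    and "\<mu>0 \<in> borel_probability_measures" "\<mu>1 \<in> borel_probability_measures"
    and "0 < \<delta>"
  shows "\<exists>\<pi>\<in>couplings \<mu>0 \<mu>1.
    prob_space \<pi> \<and> integrable \<pi> (\<lambda>z. (dist (fst z) (snd z))\<^sup>2) \<and>
    (\<integral>z. (dist (fst z) (snd z))\<^sup>2 \<partial>\<pi>) < (W2 \<mu>0 \<mu>1)\<^sup>2 + \<delta>"
proof -
  define C where "C \<pi> = (\<integral>\<^sup>+z. ennreal ((dist (fst z) (snd z))\<^sup>2) \<partial>\<pi>)" for \<pi> :: "('a \<times> 'a) measure"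
  define c where "c = (INF \<pi>\<in>couplings \<mu>0 \<mu>1. C \<pi>)"
  \<comment> \<open>\<open>couplings\<close> does not mention total mass; it is inherited from the
    first marginal.\<close>
  have prob: "prob_space \<pi>" if "\<pi> \<in> couplings \<mu>0 \<mu>1" for \<pi>
  proof -
    have [measurable_cong]: "sets \<pi> = sets borel" and "distr \<pi> borel fst = \<mu>0"
      using that by (auto simp: couplings_def)
    then show ?thesis
      using assms(2) by (intro prob_space_distrD[of fst \<pi> borel])
        (auto simp: borel_probability_measures_def measurable_cong_sets[OF \<open>sets \<pi> = sets borel\<close> refl]
          intro!: borel_measurable_continuous_onI continuous_intros)
  qed
  obtain B where B: "\<And>x y :: 'a. dist x y \<le> B"
    using compact_imp_bounded[OF assms(1)] unfolding bounded_two_points by auto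
  have C_le: "C \<pi> \<le> ennreal (B\<^sup>2)" if "\<pi> \<in> couplings \<mu>0 \<mu>1" for \<pi>
  proof -
    interpret prob_space \<pi> by (rule prob[OF that])
    have "C \<pi> \<le> (\<integral>\<^sup>+z. ennreal (B\<^sup>2) \<partial>\<pi>)"
      unfolding C_def by (intro nn_integral_mono ennreal_leI power_mono B) auto
    then show ?thesis by (simp add: emeasure_space_1)
  qed
  have \<pi>: "\<mu>0 \<Otimes>\<^sub>M \<mu>1 \<in> couplings \<mu>0 \<mu>1"
    using assms by (intro pair_measure_in_couplings)
  have "c \<le> ennreal (B\<^sup>2)"
    unfolding c_def using \<pi> C_le by (auto intro: INF_lower2)
  then have "c \<noteq> \<infinity>"
    by (auto simp: top_unique)
  then have c: "c = ennreal ((W2 \<mu>0 \<mu>1)\<^sup>2)"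
    by (simp add: W2_def less_top flip: c_def[unfolded C_def])
  also have "\<dots> < ennreal ((W2 \<mu>0 \<mu>1)\<^sup>2 + \<delta>)"
    using \<open>0 < \<delta>\<close> by (simp add: ennreal_less_iff)
  finally obtain \<pi> where \<pi>: "\<pi> \<in> couplings \<mu>0 \<mu>1" "C \<pi> < ennreal ((W2 \<mu>0 \<mu>1)\<^sup>2 + \<delta>)"
    unfolding c_def by (auto simp: INF_less_iff)
  interpret prob_space \<pi> by (rule prob[OF \<pi>(1)])
  have [measurable_cong]: "sets \<pi> = sets borel"
    using \<pi> by (auto simp: couplings_def)
  have [measurable]: "(\<lambda>z. dist (fst z) (snd z)) \<in> borel_measurable \<pi>"
    unfolding measurable_cong_sets[OF \<open>sets \<pi> = sets borel\<close> refl]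
    by (intro borel_measurable_continuous_onI continuous_intros)
  have int: "integrable \<pi> (\<lambda>z. (dist (fst z) (snd z))\<^sup>2)"
    by (intro integrable_const_bound[where B = "B\<^sup>2"]) (auto intro!: power_mono B)
  have "ennreal (\<integral>z. (dist (fst z) (snd z))\<^sup>2 \<partial>\<pi>) = C \<pi>"
    unfolding C_def using int by (intro nn_integral_eq_integral[symmetric]) auto
  then have "(\<integral>z. (dist (fst z) (snd z))\<^sup>2 \<partial>\<pi>) < (W2 \<mu>0 \<mu>1)\<^sup>2 + \<delta>"
    using \<pi>(2) ennreal_less_iff[of "\<integral>z. (dist (fst z) (snd z))\<^sup>2 \<partial>\<pi>"] by simp
  then show ?thesis
    using \<pi>(1) int prob_space_axioms by blast
qed

section \<open>Lebesgue decompositions\<close>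

text \<open>Existence is what gives the \<open>SOME\<close> in \<open>U_functional\<close> its
  meaning. After the part on a maximal null set is split off, the rest is absolutely continuous and
  Radon-Nikodym applies.\<close>

lemma ex_lebesgue_decomposition:
  assumes "finite_measure \<nu>" "finite_measure \<mu>" and sets: "sets \<mu> = sets \<nu>"
  shows "\<exists>\<rho> \<mu>s. lebesgue_decomposition \<nu> \<mu> \<rho> \<mu>s"
proof -
  interpret \<nu>: finite_measure \<nu> by fact
  interpret \<mu>: finite_measure \<mu> by fact
  note [measurable_cong] = sets
  \<comment> \<open>The singular part lives on a \<open>\<nu>\<close>-null set of maximal \<open>\<mu>\<close>-measure.\<close>
  have "emeasure \<mu> ` null_sets \<nu> \<noteq> {}"
    using null_sets.empty_sets by blast
  from ennreal_Sup_countable_SUP[OF this] obtain m :: "nat \<Rightarrow> ennreal"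
    where m: "range m \<subseteq> emeasure \<mu> ` null_sets \<nu>" "(SUP N\<in>null_sets \<nu>. emeasure \<mu> N) = (SUP i. m i)"
    by (elim exE conjE) (rule that)
  then have "\<forall>i. \<exists>N\<in>null_sets \<nu>. m i = emeasure \<mu> N"
    by auto
  then obtain S where S: "\<And>i :: nat. S i \<in> null_sets \<nu>" "\<And>i. m i = emeasure \<mu> (S i)"
    by metis
  define N where "N = (\<Union>i. S i)"
  have N: "N \<in> null_sets \<nu>"
    unfolding N_def using S by (intro null_sets_UN)
  then have [measurable]: "N \<in> sets \<nu>" by auto
  have max: "emeasure \<mu> A \<le> emeasure \<mu> N" if "A \<in> null_sets \<nu>" for A
  proof -
    have "emeasure \<mu> A \<le> (SUP i. m i)"
      unfolding m(2)[symmetric] using that by (rule SUP_upper)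
    also have "\<dots> \<le> emeasure \<mu> N"
      unfolding S N_def using S(1) sets by (intro SUP_least emeasure_mono) auto
    finally show ?thesis .
  qed
  define \<mu>a where "\<mu>a = density \<mu> (indicator (space \<nu> - N))"
  define \<mu>s where "\<mu>s = density \<mu> (indicator N)"
  have \<mu>a: "emeasure \<mu>a A = emeasure \<mu> (A - N)" if "A \<in> sets \<nu>" for A
  proof -
    have "emeasure \<mu>a A = emeasure \<mu> ((space \<nu> - N) \<inter> A)"
      unfolding \<mu>a_def using that sets by (subst emeasure_density) (auto simp flip: indicator_inter_arith)
    also have "(space \<nu> - N) \<inter> A = A - N"
      using sets.sets_into_space[OF that] by auto
    finally show ?thesis .
  qed
  have \<mu>s: "emeasure \<mu>s A = emeasure \<mu> (A \<inter> N)" if "A \<in> sets \<nu>" for A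
    unfolding \<mu>s_def using that sets
    by (subst emeasure_density) (auto simp: Int_commute simp flip: indicator_inter_arith)
  have sets_a: "sets \<mu>a = sets \<nu>" and sets_s: "sets \<mu>s = sets \<nu>"
    by (auto simp: \<mu>a_def \<mu>s_def sets)
  \<comment> \<open>If a null set \<open>A\<close> had mass outside \<open>N\<close>, the null set
    \<open>A \<union> N\<close> would beat the maximality of \<open>N\<close>; finiteness of
    \<open>\<mu>\<close> permits the cancellation.\<close>
  have "absolutely_continuous \<nu> \<mu>a"
    unfolding absolutely_continuous_def
  proof
    fix A assume A: "A \<in> null_sets \<nu>"
    then have A': "A \<in> sets \<mu>" "N \<in> sets \<mu>"
      by (simp_all add: sets null_setsD2)
    have "emeasure \<mu> (A - N) + emeasure \<mu> N = emeasure \<mu> (A \<union> N)"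
      by (subst plus_emeasure) (use A' in \<open>auto simp: Un_Diff_cancel2\<close>)
    also have "\<dots> \<le> emeasure \<mu> N"
      using A N by (intro max null_sets.Un)
    finally have "emeasure \<mu> (A - N) = 0"
      using ennreal_add_left_cancel_le[of "emeasure \<mu> N" "emeasure \<mu> (A - N)" 0] \<mu>.emeasure_finite[of N]
      by (simp add: add.commute)
    then show "A \<in> null_sets \<mu>a"
      using null_setsD2[OF A] \<mu>a[of A] sets_a by (intro null_setsI) simp_all
  qed
  moreover have fin_a: "emeasure \<mu>a (space \<nu>) \<noteq> \<infinity>"
    using \<mu>a[of "space \<nu>"] \<mu>.emeasure_finite by simp
  then have "finite_measure \<mu>a"
    by (intro finite_measureI) (simp add: sets_eq_imp_space_eq[OF sets_a])
  ultimately obtain f where [measurable]: "f \<in> borel_measurable \<nu>" and f: "density \<nu> f = \<mu>a"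
    using \<nu>.Radon_Nikodym_finite_measure sets_a by blast
  have "(\<integral>\<^sup>+x. f x \<partial>\<nu>) = emeasure \<mu>a (space \<nu>)"
    unfolding f[symmetric] by (subst emeasure_density) (auto intro!: nn_integral_cong)
  \<comment> \<open>The decomposition asks for a real density, and finiteness of
    \<open>\<mu>a\<close> confines the value \<open>\<infinity>\<close> to a null set.\<close>
  then have "AE x in \<nu>. f x \<noteq> \<infinity>"
    using fin_a by (intro nn_integral_PInf_AE) auto
  then have AE_f: "AE x in \<nu>. ennreal (enn2real (f x)) = f x"
    by eventually_elim (simp add: less_top)
  have "lebesgue_decomposition \<nu> \<mu> (\<lambda>x. enn2real (f x)) \<mu>s"
    unfolding lebesgue_decomposition_def
  proof (intro conjI ballI allI bexI[of _ N])
    fix A assume A: "A \<in> sets \<nu>"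
    have "emeasure \<mu> A = emeasure \<mu>a A + emeasure \<mu>s A"
      unfolding \<mu>a[OF A] \<mu>s[OF A] using A sets
      by (subst plus_emeasure) (auto intro!: arg_cong[where f = "emeasure \<mu>"])
    also have "emeasure \<mu>a A = (\<integral>\<^sup>+x\<in>A. f x \<partial>\<nu>)"
      unfolding f[symmetric] using A by (simp add: emeasure_density)
    also have "\<dots> = (\<integral>\<^sup>+x\<in>A. ennreal (enn2real (f x)) \<partial>\<nu>)"
      using AE_f by (intro nn_integral_cong_AE) auto
    finally show "emeasure \<mu> A = (\<integral>\<^sup>+x\<in>A. ennreal (enn2real (f x)) \<partial>\<nu>) + emeasure \<mu>s A" .
  next
    show "emeasure \<mu>s (space \<nu> - N) = 0"
      by (subst \<mu>s) (auto simp: Diff_Int_distrib2)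
  qed (use N sets_s in auto)
  then show ?thesis by blast
qed

lemma extended_integral_eq_integral:
  assumes "integrable M f"
  shows "extended_integral M f = ereal (\<integral>x. f x \<partial>M)"
proof -
  have "(\<integral>\<^sup>+x. ennreal (f x) \<partial>M) \<noteq> \<infinity>" "(\<integral>\<^sup>+x. ennreal (- f x) \<partial>M) \<noteq> \<infinity>"
    using assms by (auto simp: real_integrable_def)
  then obtain a b where "(\<integral>\<^sup>+x. ennreal (f x) \<partial>M) = ennreal a" "0 \<le> a"
    "(\<integral>\<^sup>+x. ennreal (- f x) \<partial>M) = ennreal b" "0 \<le> b"
    by (metis ennreal_cases infinity_ennreal_def)
  then show ?thesis
    by (simp add: extended_integral_def real_lebesgue_integral_def[OF assms])
qed

text \<open>The choice by \<open>SOME\<close> does not involve \<open>U\<close>, so one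
  decomposition serves every \<open>U\<close>.\<close>

lemma U_functional_cases:
  assumes "prob_space \<nu>" "prob_space \<mu>" "sets \<mu> = sets \<nu>"
  obtains \<rho> \<mu>s where "lebesgue_decomposition \<nu> \<mu> \<rho> \<mu>s"
    "\<And>U. U_functional \<nu> U \<mu> =
      extended_integral \<nu> (\<lambda>x. U (\<rho> x)) + U_prime_inf U * enn2ereal (emeasure \<mu>s (space \<nu>))"
proof -
  obtain p where p: "p = (SOME (\<rho>, \<mu>s). lebesgue_decomposition \<nu> \<mu> \<rho> \<mu>s)" by simp
  have "\<exists>q. (\<lambda>(\<rho>, \<mu>s). lebesgue_decomposition \<nu> \<mu> \<rho> \<mu>s) q"
    using ex_lebesgue_decomposition[of \<nu> \<mu>] assms by (auto intro: prob_space.finite_measure)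
  then have "(\<lambda>(\<rho>, \<mu>s). lebesgue_decomposition \<nu> \<mu> \<rho> \<mu>s) p"
    unfolding p by (rule someI_ex)
  then show thesis
    by (intro that[of "fst p" "snd p"]) (auto simp: U_functional_def p[symmetric] split: prod.splits)
qed

text \<open>Uniqueness of the decomposition: absolute continuity makes the carrier \<open>N\<close>
  of the singular part \<open>\<mu>\<close>-null, so the singular part vanishes and the chosen
  density agrees with \<open>\<rho>\<close> almost everywhere. The term at infinity then disappears
  by \<open>\<infinity> * 0 = 0\<close>.\<close>

lemma U_functional_density:
  assumes "prob_space \<nu>" "prob_space (density \<nu> (\<lambda>x. ennreal (\<rho> x)))"
    and [measurable]: "\<rho> \<in> borel_measurable \<nu>" and \<rho>: "\<And>x. 0 \<le> \<rho> x"
    and int: "integrable \<nu> (\<lambda>x. U (\<rho> x))"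
  shows "U_functional \<nu> U (density \<nu> (\<lambda>x. ennreal (\<rho> x))) = ereal (\<integral>x. U (\<rho> x) \<partial>\<nu>)"
proof -
  interpret prob_space \<nu> by fact
  let ?\<mu> = "density \<nu> (\<lambda>x. ennreal (\<rho> x))"
  obtain \<rho>' \<mu>s where dec: "lebesgue_decomposition \<nu> ?\<mu> \<rho>' \<mu>s"
    and U: "U_functional \<nu> U ?\<mu> =
      extended_integral \<nu> (\<lambda>x. U (\<rho>' x)) + U_prime_inf U * enn2ereal (emeasure \<mu>s (space \<nu>))"
    using U_functional_cases[OF assms(1,2)] by (metis sets_density)
  from dec obtain N where N: "N \<in> sets \<nu>" "emeasure \<nu> N = 0" "emeasure \<mu>s (space \<nu> - N) = 0"
    and sets: "sets \<mu>s = sets \<nu>" and [measurable]: "\<rho>' \<in> borel_measurable \<nu>"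
    and \<rho>': "\<And>x. 0 \<le> \<rho>' x"
    and eq: "\<And>A. A \<in> sets \<nu> \<Longrightarrow> emeasure ?\<mu> A = (\<integral>\<^sup>+x\<in>A. ennreal (\<rho>' x) \<partial>\<nu>) + emeasure \<mu>s A"
    by (auto simp: lebesgue_decomposition_def)
  have "absolutely_continuous \<nu> ?\<mu>"
    by (intro absolutely_continuousI_density) simp
  then have "emeasure ?\<mu> N = 0"
    using N by (auto simp: absolutely_continuous_def)
  then have "emeasure \<mu>s N = 0"
    using eq[OF N(1)] by simp
  then have "emeasure \<mu>s (N \<union> (space \<nu> - N)) \<le> 0"
    using emeasure_subadditive[of N \<mu>s "space \<nu> - N"] N sets by simp
  moreover have "N \<union> (space \<nu> - N) = space \<nu>"
    using sets.sets_into_space[OF N(1)] by auto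
  ultimately have \<mu>s: "emeasure \<mu>s (space \<nu>) = 0" by simp
  have "emeasure \<mu>s A = 0" if "A \<in> sets \<nu>" for A
    using \<mu>s emeasure_mono[of A "space \<nu>" \<mu>s] sets.sets_into_space[OF that] sets by simp
  then have "AE x in \<nu>. ennreal (\<rho> x) = ennreal (\<rho>' x)"
    using eq by (intro density_unique2) (simp_all add: emeasure_density)
  then have "AE x in \<nu>. \<rho> x = \<rho>' x"
    by eventually_elim (simp add: \<rho> \<rho>')
  then have "extended_integral \<nu> (\<lambda>x. U (\<rho>' x)) = extended_integral \<nu> (\<lambda>x. U (\<rho> x))"
    unfolding extended_integral_def
    by (intro arg_cong2[where f = minus] arg_cong[where f = enn2ereal] nn_integral_cong_AE) auto
  then show ?thesis
    using U \<mu>s extended_integral_eq_integral[OF int] by (simp add: zero_ennreal.rep_eq)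
qed

text \<open>One half of the Gibbs (Donsker--Varadhan) variational principle.\<close>

lemma U_functional_ent_ge:
  assumes "prob_space \<nu>" "prob_space \<mu>" and sets: "sets \<mu> = sets \<nu>"
    and meas: "\<phi> \<in> borel_measurable \<nu>" and bound: "\<And>x. \<bar>\<phi> x\<bar> \<le> B"
    and exp: "(\<integral>x. exp (\<phi> x) \<partial>\<nu>) = 1"
  shows "ereal (\<integral>x. \<phi> x \<partial>\<mu>) \<le> U_functional \<nu> ent \<mu>"
proof -
  interpret \<nu>: prob_space \<nu> by fact
  interpret \<mu>: prob_space \<mu> by fact
  note [measurable] = meas
  obtain \<rho> \<mu>s where dec: "lebesgue_decomposition \<nu> \<mu> \<rho> \<mu>s"
    and U: "U_functional \<nu> ent \<mu> =
      extended_integral \<nu> (\<lambda>x. ent (\<rho> x)) + U_prime_inf ent * enn2ereal (emeasure \<mu>s (space \<nu>))"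
    using U_functional_cases[OF assms(1-3)] by metis
  from dec have sets_s: "sets \<mu>s = sets \<nu>" and [measurable]: "\<rho> \<in> borel_measurable \<nu>"
    and \<rho>: "\<And>x. 0 \<le> \<rho> x"
    and eq: "\<And>A. A \<in> sets \<nu> \<Longrightarrow> emeasure \<mu> A = (\<integral>\<^sup>+x\<in>A. ennreal (\<rho> x) \<partial>\<nu>) + emeasure \<mu>s A"
    by (auto simp: lebesgue_decomposition_def)
  \<comment> \<open>Since \<open>ent \<ge> -1\<close> and \<open>\<nu>\<close> has mass one, the
    negative part is finite and no \<open>\<infinity> - \<infinity>\<close> can arise.\<close>
  have "(\<integral>\<^sup>+x. ennreal (- ent (\<rho> x)) \<partial>\<nu>) \<le> (\<integral>\<^sup>+x. 1 \<partial>\<nu>)"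
    using ent_ge \<rho> by (intro nn_integral_mono) (simp add: minus_le_iff)
  then have neg: "(\<integral>\<^sup>+x. ennreal (- ent (\<rho> x)) \<partial>\<nu>) \<noteq> \<infinity>"
    by (auto simp: \<nu>.emeasure_space_1 top_unique)
  then obtain b where b: "(\<integral>\<^sup>+x. ennreal (- ent (\<rho> x)) \<partial>\<nu>) = ennreal b" "0 \<le> b"
    by (metis ennreal_cases infinity_ennreal_def)
  show ?thesis
  proof (cases "emeasure \<mu>s (space \<nu>) = 0 \<and> (\<integral>\<^sup>+x. ennreal (ent (\<rho> x)) \<partial>\<nu>) \<noteq> \<infinity>")
    case False
    then have "U_functional \<nu> ent \<mu> = \<infinity>"
    proof (cases "emeasure \<mu>s (space \<nu>) = 0")
      case False
      then have "0 < enn2ereal (emeasure \<mu>s (space \<nu>))"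
        by (metis enn2ereal_nonneg enn2ereal_inject less_le zero_ennreal.rep_eq)
      moreover have "extended_integral \<nu> (\<lambda>x. ent (\<rho> x)) \<noteq> - \<infinity>"
        unfolding extended_integral_def using b
        by (cases "\<integral>\<^sup>+x. ennreal (ent (\<rho> x)) \<partial>\<nu>") auto
      ultimately show ?thesis
        by (auto simp: U U_prime_inf_ent)
    qed (use False b in \<open>auto simp: U extended_integral_def zero_ennreal.rep_eq\<close>)
    then show ?thesis by simp
  next
    case True
    have [measurable]: "(\<lambda>x. ent (\<rho> x)) \<in> borel_measurable \<nu>"
      unfolding ent_def by measurable
    have int_ent: "integrable \<nu> (\<lambda>x. ent (\<rho> x))"
      using True neg by (simp add: real_integrable_def)
    have U: "U_functional \<nu> ent \<mu> = ereal (\<integral>x. ent (\<rho> x) \<partial>\<nu>)"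
      using U True extended_integral_eq_integral[OF int_ent] by (simp add: zero_ennreal.rep_eq)
    have "emeasure \<mu>s A = 0" if "A \<in> sets \<nu>" for A
      using True emeasure_mono[of A "space \<nu>" \<mu>s] sets.sets_into_space[OF that] sets_s by simp
    then have \<mu>: "\<mu> = density \<nu> (\<lambda>x. ennreal (\<rho> x))"
      using eq sets by (intro measure_eqI) (simp_all add: emeasure_density)
    have "(\<integral>\<^sup>+x. ennreal (\<rho> x) \<partial>\<nu>) = emeasure \<mu> (space \<nu>)"
      unfolding \<mu> by (subst emeasure_density) (auto intro!: nn_integral_cong)
    also have "\<dots> = 1"
      using \<mu>.emeasure_space_1 sets_eq_imp_space_eq[OF sets] by simp
    finally have \<rho>1: "(\<integral>\<^sup>+x. ennreal (\<rho> x) \<partial>\<nu>) = 1" .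
    then have int_\<rho>: "integrable \<nu> \<rho>"
      using \<rho> by (intro integrableI_nonneg) auto
    have "(\<integral>x. \<rho> x \<partial>\<nu>) = 1"
      using \<rho>1 \<rho> by (simp add: integral_eq_nn_integral)
    have int_exp: "integrable \<nu> (\<lambda>x. exp (\<phi> x))"
      using bound by (intro \<nu>.integrable_const_bound[where B = "exp B"]) (auto simp: abs_le_iff)
    have "\<rho> x * \<bar>\<phi> x\<bar> \<le> \<bar>B\<bar> * \<rho> x" for x
      using mult_left_mono[OF order_trans[OF bound[of x] abs_ge_self] \<rho>[of x]] by (simp add: mult.commute)
    then have int_\<rho>\<phi>: "integrable \<nu> (\<lambda>x. \<rho> x * \<phi> x)"
      using \<rho>
      by (intro Bochner_Integration.integrable_bound[OF integrable_mult_right[OF int_\<rho>, of B]])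
        (auto simp: abs_mult)
    have "(\<integral>x. \<phi> x \<partial>\<mu>) = (\<integral>x. \<rho> x * \<phi> x \<partial>\<nu>)"
      unfolding \<mu> using \<rho> by (subst integral_density) auto
    \<comment> \<open>The added terms integrate to \<open>1 - 1 = 0\<close> and complete the
      integrand to the tangent of \<open>ent\<close> at \<open>exp (\<phi> x)\<close>.\<close>
    also have "\<dots> = (\<integral>x. \<rho> x * \<phi> x + \<rho> x - exp (\<phi> x) \<partial>\<nu>)"
      using int_\<rho> int_\<rho>\<phi> int_exp exp \<open>(\<integral>x. \<rho> x \<partial>\<nu>) = 1\<close> by simp
    also have "\<dots> \<le> (\<integral>x. ent (\<rho> x) \<partial>\<nu>)"
      using int_\<rho> int_\<rho>\<phi> int_exp int_ent \<rho> ent_ge_tangent[OF \<rho>, of "exp (\<phi> _)"]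
      by (intro integral_mono) auto
    finally show ?thesis
      by (simp add: U)
  qed
qed

section \<open>Transport and the entropy--slope inequality\<close>

text \<open>A pointwise bound on \<open>\<phi> x - \<phi> y\<close> is integrated against a nearly
  optimal coupling. Moves shorter than \<open>r\<close> are controlled by the slope at the starting
  point, longer ones by the Lipschitz constant, whose contribution is charged to the transport cost.
  The weight \<open>a\<close> of AM-GM stays free.\<close>

lemma integral_diff_le_W2:
  fixes \<mu>0 \<mu>1 :: "'a::metric_space measure"
  assumes compact: "compact (UNIV :: 'a set)"
    and \<mu>: "\<mu>0 \<in> borel_probability_measures" "\<mu>1 \<in> borel_probability_measures"
    and lip: "L-lipschitz_on UNIV h"
    and meas: "\<phi> \<in> borel_measurable borel" and bound: "\<And>x. \<bar>\<phi> x\<bar> \<le> B"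
    and \<phi>: "\<And>x y. \<bar>\<phi> x - \<phi> y\<bar> \<le> c * \<bar>h x - h y\<bar>"
    and pos: "0 \<le> c" "0 < a" "0 < r"
  shows "(\<integral>x. \<phi> x \<partial>\<mu>0) - (\<integral>x. \<phi> x \<partial>\<mu>1) \<le>
    (a / 2 + c\<^sup>2 * L\<^sup>2 / (2 * a * r\<^sup>2)) * (W2 \<mu>0 \<mu>1)\<^sup>2
      + c\<^sup>2 / (2 * a) * (\<integral>x. (slope_within h r x)\<^sup>2 \<partial>\<mu>0)"
proof (rule field_le_epsilon)
  fix e :: real assume "0 < e"
  define A where "A = a / 2 + c\<^sup>2 * L\<^sup>2 / (2 * a * r\<^sup>2)"
  define g where "g = slope_within h r"
  have "0 < A"
    using pos unfolding A_def by (intro add_pos_nonneg) auto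
  have "0 \<le> L"
    using lip by (rule lipschitz_on_nonneg)
  have g_meas: "g \<in> borel_measurable borel" and g: "0 \<le> g x" "g x \<le> L" for x
    using slope_within_measurable[OF lip] slope_within_nonneg[OF lip] slope_within_le[OF lip] pos
    by (auto simp: g_def)
  have pointwise: "\<phi> x - \<phi> y \<le> A * (dist x y)\<^sup>2 + c\<^sup>2 / (2 * a) * (g x)\<^sup>2" for x y
  proof -
    \<comment> \<open>Stated for arbitrary \<open>s\<close>, since it is used with the slope for
      short moves and with \<open>L\<close> for long ones.\<close>
    have amgm: "c * (s * dist x y) \<le> a / 2 * (dist x y)\<^sup>2 + c\<^sup>2 / (2 * a) * s\<^sup>2" for s
    proof -
      have "0 \<le> (a * dist x y - c * s)\<^sup>2 / (2 * a)"
        using pos by simp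
      also have "\<dots> = a / 2 * (dist x y)\<^sup>2 + c\<^sup>2 / (2 * a) * s\<^sup>2 - c * (s * dist x y)"
        using pos by (simp add: field_simps power2_eq_square)
      finally show ?thesis by simp
    qed
    have \<phi>_le: "\<phi> x - \<phi> y \<le> c * \<bar>h x - h y\<bar>"
      using \<phi>[of x y] by simp
    show ?thesis
    proof (cases "dist x y < r")
      case True
      have "c * \<bar>h x - h y\<bar> \<le> c * (g x * dist x y)"
        using diff_le_slope_within[OF lip True] pos by (simp add: g_def mult_left_mono)
      also note amgm
      also have "a / 2 * (dist x y)\<^sup>2 \<le> A * (dist x y)\<^sup>2"
        using pos by (intro mult_right_mono) (auto simp: A_def)
      finally show ?thesis
        using \<phi>_le by simp
    next
      case False
      have "c * \<bar>h x - h y\<bar> \<le> c * (L * dist x y)"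
        using lipschitz_onD[OF lip, of x y] pos by (auto simp: dist_real_def intro!: mult_left_mono)
      also note amgm
      \<comment> \<open>A long move satisfies \<open>1 \<le> (dist x y / r)\<^sup>2\<close>, which
        turns the constant into a multiple of the cost. This is the second summand of
        \<open>A\<close>.\<close>
      also have "c\<^sup>2 / (2 * a) * L\<^sup>2 \<le> c\<^sup>2 / (2 * a) * (L\<^sup>2 * ((dist x y)\<^sup>2 / r\<^sup>2))"
      proof -
        have "1 \<le> (dist x y)\<^sup>2 / r\<^sup>2"
          using False pos by (simp add: power_mono)
        then show ?thesis
          using pos mult_left_mono[of 1 "(dist x y)\<^sup>2 / r\<^sup>2" "L\<^sup>2"] by (intro mult_left_mono) auto
      qed
      also have "a / 2 * (dist x y)\<^sup>2 + \<dots> = A * (dist x y)\<^sup>2"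
        by (simp add: A_def algebra_simps)
      finally show ?thesis
        using \<phi>_le pos by (smt (verit) divide_nonneg_pos zero_le_power2 mult_nonneg_nonneg)
    qed
  qed
  \<comment> \<open>The slack \<open>e / A\<close> becomes \<open>e\<close> once the cost is
    multiplied by \<open>A\<close>.\<close>
  obtain \<pi> where \<pi>: "\<pi> \<in> couplings \<mu>0 \<mu>1" "prob_space \<pi>"
    "integrable \<pi> (\<lambda>z. (dist (fst z) (snd z))\<^sup>2)"
    "(\<integral>z. (dist (fst z) (snd z))\<^sup>2 \<partial>\<pi>) < (W2 \<mu>0 \<mu>1)\<^sup>2 + e / A"
    using ex_coupling_cost_less[OF compact \<mu>, of "e / A"] \<open>0 < e\<close> \<open>0 < A\<close> by auto
  interpret prob_space \<pi> by fact
  have sets: "sets \<pi> = sets borel" and fst: "distr \<pi> borel fst = \<mu>0" and snd: "distr \<pi> borel snd = \<mu>1"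
    using \<pi>(1) by (auto simp: couplings_def)
  have [measurable]: "fst \<in> measurable \<pi> borel" "snd \<in> measurable \<pi> borel"
    unfolding measurable_cong_sets[OF sets refl]
    by (auto intro!: borel_measurable_continuous_onI continuous_intros)
  note [measurable] = meas g_meas
  have int_\<phi>: "integrable \<pi> (\<lambda>z. \<phi> (fst z))" "integrable \<pi> (\<lambda>z. \<phi> (snd z))"
    using bound by (auto intro!: integrable_const_bound[where B = B])
  have int_g: "integrable \<pi> (\<lambda>z. (g (fst z))\<^sup>2)"
    using g by (intro integrable_const_bound[where B = "L\<^sup>2"]) (auto intro!: power_mono)
  have "(\<integral>x. \<phi> x \<partial>\<mu>0) - (\<integral>x. \<phi> x \<partial>\<mu>1) = (\<integral>z. \<phi> (fst z) - \<phi> (snd z) \<partial>\<pi>)"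
    unfolding fst[symmetric] snd[symmetric] using int_\<phi> by (simp add: integral_distr)
  also have "\<dots> \<le> (\<integral>z. A * (dist (fst z) (snd z))\<^sup>2 + c\<^sup>2 / (2 * a) * (g (fst z))\<^sup>2 \<partial>\<pi>)"
    using int_\<phi> int_g \<pi>(3) pointwise by (intro integral_mono) auto
  also have "\<dots> = A * (\<integral>z. (dist (fst z) (snd z))\<^sup>2 \<partial>\<pi>) + c\<^sup>2 / (2 * a) * (\<integral>z. (g (fst z))\<^sup>2 \<partial>\<pi>)"
    using int_g \<pi>(3) by simp
  also have "(\<integral>z. (g (fst z))\<^sup>2 \<partial>\<pi>) = (\<integral>x. (g x)\<^sup>2 \<partial>\<mu>0)"
    unfolding fst[symmetric] by (simp add: integral_distr)
  also have "A * (\<integral>z. (dist (fst z) (snd z))\<^sup>2 \<partial>\<pi>) \<le> A * ((W2 \<mu>0 \<mu>1)\<^sup>2 + e / A)"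
    using \<pi>(4) \<open>0 < A\<close> by (intro mult_left_mono) auto
  also have "\<dots> = A * (W2 \<mu>0 \<mu>1)\<^sup>2 + e"
    using \<open>0 < A\<close> by (simp add: field_simps)
  finally show "(\<integral>x. \<phi> x \<partial>\<mu>0) - (\<integral>x. \<phi> x \<partial>\<mu>1) \<le>
    (a / 2 + c\<^sup>2 * L\<^sup>2 / (2 * a * r\<^sup>2)) * (W2 \<mu>0 \<mu>1)\<^sup>2
      + c\<^sup>2 / (2 * a) * (\<integral>x. (slope_within h r x)\<^sup>2 \<partial>\<mu>0) + e"
    by (simp add: A_def g_def)
qed

lemma measure_supp_density_subset:
  assumes "absolutely_continuous \<nu> \<mu>" "sets \<nu> = sets borel"
  shows "measure_supp \<mu> \<subseteq> measure_supp \<nu>"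
proof -
  have "emeasure \<mu> V = 0" if "open V" "emeasure \<nu> V = 0" for V
    using assms that by (auto simp: absolutely_continuous_def null_sets_def subset_iff)
  then show ?thesis
    unfolding measure_supp_def by (auto simp: zero_less_iff_neq_zero)
qed

text \<open>A logarithmic Sobolev inequality: \<open>exp (\<phi> x)\<close> is a probability
  density, and \<open>c\<close> times the slope of \<open>h\<close> stands in for the gradient of
  its logarithm, so the right side plays the role of Fisher information over
  \<open>2 * K\<close>.\<close>

lemma entropy_le_slope:
  fixes \<nu> :: "'a::metric_space measure"
  assumes compact: "compact (UNIV :: 'a set)" and \<nu>: "\<nu> \<in> borel_probability_measures"
    and Ric: "inf_Ricci_bounded_below \<nu> K" and "0 < K"
    and lip: "L-lipschitz_on UNIV h"
    and meas: "\<phi> \<in> borel_measurable borel" and bound: "\<And>x. \<bar>\<phi> x\<bar> \<le> B"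
    and \<phi>: "\<And>x y. \<bar>\<phi> x - \<phi> y\<bar> \<le> c * \<bar>h x - h y\<bar>" and "0 \<le> c"
    and exp: "(\<integral>x. exp (\<phi> x) \<partial>\<nu>) = 1" and "0 < r"
  shows "(\<integral>x. ent (exp (\<phi> x)) \<partial>\<nu>) \<le>
    c\<^sup>2 / (2 * K) * (\<integral>x. exp (\<phi> x) * (slope_within h r x)\<^sup>2 \<partial>\<nu>)"
proof -
  interpret prob_space \<nu> using \<nu> by (simp add: borel_probability_measures_def)
  have sets [measurable_cong]: "sets \<nu> = sets borel"
    using \<nu> by (simp add: borel_probability_measures_def)
  have space: "space \<nu> = UNIV"
    using sets_eq_imp_space_eq[OF sets] by simp
  note [measurable] = meas slope_within_measurable[OF lip \<open>0 < r\<close>]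
  define \<mu>0 where "\<mu>0 = density \<nu> (\<lambda>x. ennreal (exp (\<phi> x)))"
  define H where "H = (\<integral>x. ent (exp (\<phi> x)) \<partial>\<nu>)"
  define W where "W = (W2 \<mu>0 \<nu>)\<^sup>2"
  define G where "G = (\<integral>x. (slope_within h r x)\<^sup>2 \<partial>\<mu>0)"
  have exp_le: "exp (\<phi> x) \<le> exp B" "\<phi> x \<le> B" "- B \<le> \<phi> x" for x
    using bound[of x] by (auto simp: abs_le_iff)
  have int_exp: "integrable \<nu> (\<lambda>x. exp (\<phi> x))"
    using exp_le by (intro integrable_const_bound[where B = "exp B"]) auto
  have "prob_space \<mu>0"
    using exp int_exp by (intro prob_spaceI) (simp add: \<mu>0_def emeasure_density space nn_integral_eq_integral)
  then have \<mu>0: "\<mu>0 \<in> borel_probability_measures"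
    by (simp add: borel_probability_measures_def \<mu>0_def sets)
  have int_ent: "integrable \<nu> (\<lambda>x. ent (exp (\<phi> x)))"
    using exp_le bound unfolding ent_def
    by (intro integrable_const_bound[where B = "exp B * B"]) (auto simp: abs_mult intro!: mult_mono)
  have U_\<mu>0: "U_functional \<nu> ent \<mu>0 = ereal H"
    unfolding \<mu>0_def H_def using \<open>prob_space \<mu>0\<close> int_ent prob_space_axioms
    by (intro U_functional_density) (auto simp: \<mu>0_def)
  have "density \<nu> (\<lambda>x. ennreal 1) = \<nu>"
    by (simp add: density_1)
  then have U_\<nu>: "U_functional \<nu> ent \<nu> = 0"
    using U_functional_density[of \<nu> "\<lambda>_. 1" ent] prob_space_axioms by (simp add: ent_def)
  \<comment> \<open>The entropy at the start is the integral of the same \<open>\<phi>\<close> that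
    tests \<open>\<mu> t\<close> in the Gibbs inequality, so only a difference of integrals of
    \<open>\<phi>\<close> has to be transported.\<close>
  have H: "H = (\<integral>x. \<phi> x \<partial>\<mu>0)"
    unfolding H_def \<mu>0_def by (subst integral_density) (auto simp: ent_def)
  obtain \<mu> where geo: "wasserstein_geodesic \<mu> \<mu>0 \<nu>"
    and conv: "\<And>U t. U \<in> DC_inf \<Longrightarrow> t \<in> {0..1} \<Longrightarrow> U_functional \<nu> U (\<mu> t) \<le>
      ereal t * U_functional \<nu> U \<nu> + ereal (1 - t) * U_functional \<nu> U \<mu>0
        - ereal (1/2) * lambda_K K U * ereal (t * (1 - t) * (W2 \<mu>0 \<nu>)\<^sup>2)"
  proof -
    have "absolutely_continuous \<nu> \<mu>0"
      unfolding \<mu>0_def by (intro absolutely_continuousI_density) simp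
    then have "measure_supp \<mu>0 \<subseteq> measure_supp \<nu>"
      using sets by (rule measure_supp_density_subset)
    from Ric[unfolded inf_Ricci_bounded_below_def, THEN bspec, THEN bspec, rule_format,
        OF \<mu>0 \<nu> this subset_refl]
    show thesis
      by (elim exE conjE) (rule that, auto)
  qed
  \<comment> \<open>This is the comparison after division by \<open>t\<close>. Both terms with
    \<open>W\<close> keep a positive power of \<open>t\<close>, so only the slope term survives as
    \<open>t\<close> tends to \<open>0\<close>.\<close>
  have "H \<le> K / 2 * t * W + c\<^sup>2 * L\<^sup>2 / (2 * K * r\<^sup>2) * t ^ 2 * W + c\<^sup>2 / (2 * K) * G"
    if t: "0 < t" "t < 1" for t
  proof -
    have \<mu>t: "\<mu> t \<in> borel_probability_measures"
      using geo t by (simp add: wasserstein_geodesic_def)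
    have "\<mu> 0 = \<mu>0" and "\<forall>t\<in>{0..1}. \<forall>s\<in>{0..1}. W2 (\<mu> t) (\<mu> s) = \<bar>t - s\<bar> * W2 \<mu>0 \<nu>"
      using geo unfolding wasserstein_geodesic_def by blast+
    then have "W2 \<mu>0 (\<mu> t) = \<bar>0 - t\<bar> * W2 \<mu>0 \<nu>"
      using t by (metis atLeastAtMost_iff less_imp_le order_refl zero_le_one)
    then have Wt: "(W2 \<mu>0 (\<mu> t))\<^sup>2 = t\<^sup>2 * W"
      by (simp add: W_def power_mult_distrib)
    have "ereal (\<integral>x. \<phi> x \<partial>\<mu> t) \<le> U_functional \<nu> ent (\<mu> t)"
      using \<mu>t bound exp prob_space_axioms sets
      by (intro U_functional_ent_ge[where B = B]) (auto simp: borel_probability_measures_def)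
    also have "\<dots> \<le> ereal ((1 - t) * H - K / 2 * (t * (1 - t) * W))"
      using conv[OF ent_in_DC_inf, of t] t by (simp add: U_\<mu>0 U_\<nu> lambda_K_ent W_def)
    finally have up: "(\<integral>x. \<phi> x \<partial>\<mu> t) \<le> (1 - t) * H - K / 2 * (t * (1 - t) * W)"
      by simp
    \<comment> \<open>This weight in AM-GM makes the transport cost cancel the convexity defect to first order
      in \<open>t\<close>.\<close>
    have "H - (\<integral>x. \<phi> x \<partial>\<mu> t) \<le>
        (K / t / 2 + c\<^sup>2 * L\<^sup>2 / (2 * (K / t) * r\<^sup>2)) * (t\<^sup>2 * W) + c\<^sup>2 / (2 * (K / t)) * G"
      unfolding H G_def Wt[symmetric]
      using t \<open>0 < K\<close> \<open>0 < r\<close> \<open>0 \<le> c\<close> by (intro integral_diff_le_W2[OF compact \<mu>0 \<mu>t lip meas bound \<phi>]) auto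
    also have "\<dots> = t * (K / 2 * W + c\<^sup>2 * L\<^sup>2 / (2 * K * r\<^sup>2) * t ^ 2 * W + c\<^sup>2 / (2 * K) * G)"
      using t \<open>0 < K\<close> \<open>0 < r\<close> by (simp add: field_simps power2_eq_square)
    finally have "t * H \<le> t * (K / 2 * W + c\<^sup>2 * L\<^sup>2 / (2 * K * r\<^sup>2) * t ^ 2 * W + c\<^sup>2 / (2 * K) * G)
        - K / 2 * (t * (1 - t) * W)"
      using up by (simp add: algebra_simps)
    also have "\<dots> = t * (K / 2 * t * W + c\<^sup>2 * L\<^sup>2 / (2 * K * r\<^sup>2) * t ^ 2 * W + c\<^sup>2 / (2 * K) * G)"
      by (simp add: algebra_simps)
    finally show ?thesis
      using t by simp
  qed
  then have "eventually (\<lambda>t. H \<le> K / 2 * t * W + c\<^sup>2 * L\<^sup>2 / (2 * K * r\<^sup>2) * t ^ 2 * W + c\<^sup>2 / (2 * K) * G)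
      (at_right 0)"
    using eventually_at_right_real[of 0 1] by (auto elim: eventually_mono)
  moreover have "((\<lambda>t. K / 2 * t * W + c\<^sup>2 * L\<^sup>2 / (2 * K * r\<^sup>2) * t ^ 2 * W + c\<^sup>2 / (2 * K) * G)
      \<longlongrightarrow> K / 2 * 0 * W + c\<^sup>2 * L\<^sup>2 / (2 * K * r\<^sup>2) * 0 ^ 2 * W + c\<^sup>2 / (2 * K) * G) (at_right 0)"
    by (intro tendsto_intros)
  ultimately have "H \<le> c\<^sup>2 / (2 * K) * G"
    by (intro tendsto_lowerbound[where F = "at_right 0"]) auto
  moreover have "G = (\<integral>x. exp (\<phi> x) * (slope_within h r x)\<^sup>2 \<partial>\<nu>)"
    unfolding G_def \<mu>0_def by (subst integral_density) auto
  ultimately show ?thesis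
    by (simp add: H_def)
qed

section \<open>Linearization and the Poincare inequality\<close>

lemma abs_ln_diff_le:
  fixes a b m :: real
  assumes "0 < m" "m \<le> a" "m \<le> b"
  shows "\<bar>ln a - ln b\<bar> \<le> \<bar>a - b\<bar> / m"
proof -
  have "ln a - ln b \<le> \<bar>a - b\<bar> / m" if "m \<le> a" "m \<le> b" for a b
  proof -
    have "ln a - ln b = ln (a / b)"
      using assms(1) that by (simp add: ln_div)
    also have "\<dots> \<le> a / b - 1"
      using assms(1) that by (intro ln_le_minus_one) auto
    also have "\<dots> = (a - b) / b"
      using assms(1) that by (simp add: field_simps)
    also have "\<dots> \<le> \<bar>a - b\<bar> / m"
      using assms(1) that by (intro frac_le) auto
    finally show ?thesis .
  qed
  from this[of a b] this[of b a] show ?thesis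
    using assms by (simp add: abs_le_iff abs_minus_commute)
qed

text \<open>The density \<open>1 + e * h\<close> has entropy \<open>e\<^sup>2 * V / 2\<close> up to
  third order, and the slope side is also of order \<open>e\<^sup>2\<close>; dividing by
  \<open>e\<^sup>2\<close> and letting \<open>e\<close> tend to \<open>0\<close> compares the
  leading coefficients. Mean zero gives the density mass one and removes the linear term.\<close>

lemma poincare_slope_within:
  fixes \<nu> :: "'a::metric_space measure"
  assumes compact: "compact (UNIV :: 'a set)" and \<nu>: "\<nu> \<in> borel_probability_measures"
    and Ric: "inf_Ricci_bounded_below \<nu> K" and "0 < K"
    and lip: "L-lipschitz_on UNIV h" and mean: "(\<integral>x. h x \<partial>\<nu>) = 0" and "0 < r"
  shows "(\<integral>x. (h x)\<^sup>2 \<partial>\<nu>) \<le> 1 / K * (\<integral>x. (slope_within h r x)\<^sup>2 \<partial>\<nu>)"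
proof -
  interpret prob_space \<nu> using \<nu> by (simp add: borel_probability_measures_def)
  have sets [measurable_cong]: "sets \<nu> = sets borel"
    using \<nu> by (simp add: borel_probability_measures_def)
  have "continuous_on UNIV h"
    using lip by (rule lipschitz_on_continuous_on)
  then have [measurable]: "h \<in> borel_measurable borel"
    by (rule borel_measurable_continuous_onI)
  note [measurable] = slope_within_measurable[OF lip \<open>0 < r\<close>]
  have "bounded (range h)"
    using compact_continuous_image[OF \<open>continuous_on UNIV h\<close> compact] by (rule compact_imp_bounded)
  then obtain M where M: "0 < M" "\<And>x. \<bar>h x\<bar> \<le> M"
    by (auto simp: bounded_pos)
  define V where "V = (\<integral>x. (h x)\<^sup>2 \<partial>\<nu>)"
  define G where "G = (\<integral>x. (slope_within h r x)\<^sup>2 \<partial>\<nu>)"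
  have int_h: "integrable \<nu> h"
    using M by (intro integrable_const_bound[where B = M]) auto
  have int_h2: "integrable \<nu> (\<lambda>x. (h x)\<^sup>2)"
    using M power_mono[OF M(2) abs_ge_zero, of _ 2] by (intro integrable_const_bound[where B = "M\<^sup>2"]) auto
  have int_slope: "integrable \<nu> (\<lambda>x. (slope_within h r x)\<^sup>2)"
    using slope_within_nonneg[OF lip \<open>0 < r\<close>] slope_within_le[OF lip \<open>0 < r\<close>]
    by (intro integrable_const_bound[where B = "L\<^sup>2"]) (auto intro!: power_mono)
  \<comment> \<open>The restriction \<open>e < 1 / M\<close> keeps \<open>1 + e * h\<close> above
    \<open>1 - e * M > 0\<close>, so its logarithm is bounded and Lipschitz in
    \<open>h\<close>.\<close>
  have "V * (1 / 2 - e * M / 6) \<le> 1 / (1 - e * M)\<^sup>2 / (2 * K) * ((1 + e * M) * G)"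
    if e: "0 < e" "e < 1 / M" for e
  proof -
    have eM: "e * M < 1"
      using e M by (simp add: field_simps)
    have eh: "\<bar>e * h x\<bar> \<le> e * M" for x
      using e M(2)[of x] by (simp add: abs_mult)
    have eh': "1 - e * M \<le> 1 + e * h x" "1 + e * h x \<le> 1 + e * M" "0 < 1 + e * h x" for x
      using eh[of x] eM by (auto simp: abs_le_iff)
    define \<phi> where "\<phi> x = ln (1 + e * h x)" for x
    \<comment> \<open>The Lipschitz constant \<open>1 / (1 - e * M)\<close> of \<open>ln\<close> on
      the range of \<open>1 + e * h\<close>, times \<open>e\<close>.\<close>
    define c where "c = e / (1 - e * M)"
    have exp_\<phi>: "exp (\<phi> x) = 1 + e * h x" for x
      using eh' by (simp add: \<phi>_def)
    have \<phi>_bound: "\<bar>\<phi> x\<bar> \<le> e * M / (1 - e * M)" for x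
    proof -
      have "\<bar>ln (1 + e * h x) - ln 1\<bar> \<le> \<bar>1 + e * h x - 1\<bar> / (1 - e * M)"
        using eh'[of x] eM e M by (intro abs_ln_diff_le) auto
      also have "\<dots> \<le> e * M / (1 - e * M)"
        using eh[of x] eM by (intro divide_right_mono) auto
      finally show ?thesis by (simp add: \<phi>_def)
    qed
    have ent_bound: "norm (ent (exp (\<phi> x))) \<le> (1 + e * M) * (e * M / (1 - e * M))" for x
      using eh'[of x] \<phi>_bound[of x] unfolding ent_def ln_exp real_norm_def abs_mult
      unfolding exp_\<phi>
      by (intro mult_mono) auto
    have "(\<integral>x. ent (exp (\<phi> x)) \<partial>\<nu>) \<le>
        c\<^sup>2 / (2 * K) * (\<integral>x. exp (\<phi> x) * (slope_within h r x)\<^sup>2 \<partial>\<nu>)"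
    proof (rule entropy_le_slope[OF compact \<nu> Ric \<open>0 < K\<close> lip])
      show "\<phi> \<in> borel_measurable borel"
        unfolding \<phi>_def by measurable
      show "\<bar>\<phi> x - \<phi> y\<bar> \<le> c * \<bar>h x - h y\<bar>" for x y
      proof -
        have "\<bar>\<phi> x - \<phi> y\<bar> \<le> \<bar>(1 + e * h x) - (1 + e * h y)\<bar> / (1 - e * M)"
          unfolding \<phi>_def using eh'[of x] eh'[of y] eM by (intro abs_ln_diff_le) auto
        also have "(1 + e * h x) - (1 + e * h y) = e * (h x - h y)"
          by (simp add: algebra_simps)
        finally show ?thesis
          using e by (simp add: c_def abs_mult)
      qed
      show "0 \<le> c"
        using e eM by (simp add: c_def)
      show "(\<integral>x. exp (\<phi> x) \<partial>\<nu>) = 1"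
        using int_h mean by (simp add: exp_\<phi> prob_space)
    qed fact+
    also have "(\<integral>x. exp (\<phi> x) * (slope_within h r x)\<^sup>2 \<partial>\<nu>) \<le>
        (\<integral>x. (1 + e * M) * (slope_within h r x)\<^sup>2 \<partial>\<nu>)"
      using int_slope eh' M e unfolding exp_\<phi>
      by (intro integral_mono' integrable_mult_right mult_right_mono) auto
    also have "\<dots> = (1 + e * M) * G"
      by (simp add: G_def)
    finally have up: "(\<integral>x. ent (exp (\<phi> x)) \<partial>\<nu>) \<le> c\<^sup>2 / (2 * K) * ((1 + e * M) * G)"
      using \<open>0 < K\<close> by (simp add: divide_right_mono mult_left_mono)
    have "e\<^sup>2 * (V * (1 / 2 - e * M / 6)) = (\<integral>x. e * h x + (e\<^sup>2 * (1 / 2 - e * M / 6)) * (h x)\<^sup>2 \<partial>\<nu>)"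
      using int_h int_h2 mean by (simp add: V_def)
    also have "\<dots> \<le> (\<integral>x. ent (exp (\<phi> x)) \<partial>\<nu>)"
    proof (rule integral_mono)
      show "integrable \<nu> (\<lambda>x. ent (exp (\<phi> x)))"
        using ent_bound by (intro integrable_const_bound[OF AE_I2]) (auto simp: ent_def \<phi>_def)
      show "e * h x + (e\<^sup>2 * (1 / 2 - e * M / 6)) * (h x)\<^sup>2 \<le> ent (exp (\<phi> x))" for x
      proof -
        have "e * h x + (e\<^sup>2 * (1 / 2 - e * M / 6)) * (h x)\<^sup>2
            = e * h x + (e * h x)\<^sup>2 / 2 - (e * M) * (e * h x)\<^sup>2 / 6"
          by (simp add: algebra_simps power2_eq_square)
        \<comment> \<open>One factor of the cubic term is bounded by \<open>e * M\<close>, so the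
          error becomes a multiple of the square of \<open>h\<close> and integrates to a multiple of
          \<open>V\<close>.\<close>
        also have "\<dots> \<le> e * h x + (e * h x)\<^sup>2 / 2 - (e * h x) * (e * h x)\<^sup>2 / 6"
          using eh[of x] by (intro diff_left_mono divide_right_mono mult_right_mono) auto
        also have "\<dots> \<le> ent (1 + e * h x)"
          using ent_1_plus_ge[of "e * h x"] eh'(3)[of x] by (simp add: power3_eq_cube power2_eq_square mult.assoc)
        finally show ?thesis
          by (simp add: exp_\<phi>)
      qed
    qed (use int_h int_h2 in auto)
    also note up
    also have "c\<^sup>2 / (2 * K) * ((1 + e * M) * G) = e\<^sup>2 * (1 / (1 - e * M)\<^sup>2 / (2 * K) * ((1 + e * M) * G))"
      by (simp add: c_def power_divide)
    finally show ?thesis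
      using e by (subst (asm) mult_le_cancel_left_pos) auto
  qed
  then have "eventually (\<lambda>e. V * (1 / 2 - e * M / 6) \<le> 1 / (1 - e * M)\<^sup>2 / (2 * K) * ((1 + e * M) * G))
      (at_right 0)"
    using eventually_at_right_real[of 0 "1 / M"] M by (auto elim: eventually_mono)
  moreover have "((\<lambda>e. V * (1 / 2 - e * M / 6)) \<longlongrightarrow> V * (1 / 2 - 0 * M / 6)) (at_right 0)"
    by (intro tendsto_intros) simp_all
  moreover have "((\<lambda>e. 1 / (1 - e * M)\<^sup>2 / (2 * K) * ((1 + e * M) * G))
      \<longlongrightarrow> 1 / (1 - 0 * M)\<^sup>2 / (2 * K) * ((1 + 0 * M) * G)) (at_right 0)"
    using \<open>0 < K\<close> by (intro tendsto_intros) auto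
  ultimately have "V * (1 / 2 - 0 * M / 6) \<le> 1 / (1 - 0 * M)\<^sup>2 / (2 * K) * ((1 + 0 * M) * G)"
    using tendsto_le[OF trivial_limit_at_right_real] by blast
  then show ?thesis
    by (simp add: V_def G_def)
qed

theorem corollary0p19:
  fixes \<nu> :: "'a::metric_space measure" and K :: real and h :: "'a \<Rightarrow> real"
  assumes "compact_measured_length_space \<nu>"
    and "inf_Ricci_bounded_below \<nu> K"
    and "K > 0"
    and "h \<in> Lip"
    and "(\<integral>x. h x \<partial>\<nu>) = 0"
  shows "(\<integral>x. (h x)\<^sup>2 \<partial>\<nu>) \<le> 1 / K * (\<integral>x. (local_slope h x)\<^sup>2 \<partial>\<nu>)"
proof -
  have compact: "compact (UNIV :: 'a set)" and \<nu>: "\<nu> \<in> borel_probability_measures"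
    using assms(1) by (auto simp: compact_measured_length_space_def)
  interpret prob_space \<nu> using \<nu> by (simp add: borel_probability_measures_def)
  have sets [measurable_cong]: "sets \<nu> = sets borel"
    using \<nu> by (simp add: borel_probability_measures_def)
  obtain L where lip: "L-lipschitz_on UNIV h"
    using assms(4) by (auto simp: Lip_def)
  have [measurable]: "slope_within h (1 / Suc n) \<in> borel_measurable borel" for n
    by (intro slope_within_measurable[OF lip]) simp
  \<comment> \<open>Measurability of the local slope is obtained from that of the
    scale-\<open>r\<close> slopes by pointwise convergence.\<close>
  have [measurable]: "local_slope h \<in> borel_measurable borel"
    by (rule borel_measurable_LIMSEQ_real[OF slope_within_tendsto[OF lip]]) measurable
  have slope: "0 \<le> slope_within h (1 / Suc n) x" "slope_within h (1 / Suc n) x \<le> L" for n x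
    using slope_within_nonneg[OF lip] slope_within_le[OF lip] by simp_all
  \<comment> \<open>The constant \<open>L\<^sup>2\<close> dominates all the squared slopes and is
    integrable for the probability measure \<open>\<nu>\<close>.\<close>
  have "(\<lambda>n. \<integral>x. (slope_within h (1 / Suc n) x)\<^sup>2 \<partial>\<nu>) \<longlonglongrightarrow> (\<integral>x. (local_slope h x)\<^sup>2 \<partial>\<nu>)"
    using slope by (intro integral_dominated_convergence[where w = "\<lambda>_. L\<^sup>2"])
      (auto intro!: tendsto_power slope_within_tendsto[OF lip] power_mono simp del: of_nat_Suc)
  then have "(\<lambda>n. 1 / K * (\<integral>x. (slope_within h (1 / Suc n) x)\<^sup>2 \<partial>\<nu>))
      \<longlonglongrightarrow> 1 / K * (\<integral>x. (local_slope h x)\<^sup>2 \<partial>\<nu>)"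
    by (intro tendsto_mult_left)
  then show ?thesis
    using poincare_slope_within[OF compact \<nu> assms(2,3) lip assms(5)]
    by (intro LIMSEQ_le_const) auto
qed

end
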